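(* Let $\mathcal G$ and $\mathcal G'$ be global assertions. If $\Phi_3(\mathcal G)=\mathcal G'$ (i.e. the lifting algorithm $\Phi_3$ terminates on $\mathcal G$ with the global assertion $\mathcal G'$ and not with a failure outcome $\mathsf{fail}(\mathcal G'',n)$), then $\overline{\mathtt{TS}}(\mathcal G')=\varnothing$.
   Context: **Global assertions.** Participants $\mathtt p,\mathtt q,\mathtt s,\mathtt r,\dots$ and variables $u,v,x,\dots$ are drawn from two disjoint countably infinite sets $\mathcal P$ and $\mathcal V$; lists $\vec v$ are identified with their sets of elements when convenient. Expressions $e$ are built from variables, basic data values and the usual arithmetic operations/relations; $\mathit{var}(e)$ is the set of variables of $e$. $\Psi$ is a fixed decidable fragment of first-order logic over such expressions, with quantifiers on variables; $\mathit{var}(\psi)$ is the set of free variables of $\psi\in\Psi$, and $\psi(\vec v)$ indicates $\mathit{var}(\psi)\subseteq\vec v$. $\supset$ is logical implication; a condition "$\phi\supset\psi$" means that the implication is valid (for all values of its free variables). $\bot$ means undefined. An interaction is $\iota=\mathtt s\to\mathtt r:\{\vec v\mid\psi\}$ with $\mathtt s,\mathtt r\in\mathcal P$, $\vec v$ a list of pairwise distinct variables (introduced by $\mathtt s$), $\psi\in\Psi$; put $\mathit{snd}(\iota)=\mathtt s$, $\mathit{rcv}(\iota)=\mathtt r$, $\mathit{var}(\iota)=\vec v$, $\mathit{cst}(\iota)=\psi$. Global assertions are generated by $$\mathcal G::=\iota.\mathcal G\ \mid\ \mathtt s\to\mathtt r:(\{\psi_j\}l_j:\mathcal G_j)_{j\in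 J}\ \mid\ \mu\,\mathbf t\langle\vec e\rangle\{\vec v\mid\psi\}.\mathcal G\ \mid\ \mathbf t\langle\vec e\rangle\ \mid\ \mathsf{end}$$ (prefix; branching with labels $l_j$ and guards $\psi_j$; recursive definition with pairwise distinct formal parameters $\vec v$, initial values $\vec e$ of the same length, and invariant $\psi$; recursive call; end). Variables $\mathit{var}(\iota)$ are bound in $\mathit{cst}(\iota)$ and in the continuation; formal parameters are bound in the body of the recursion. Recursive calls are prefix-guarded; bound variables are all distinct and differ from free ones; global assertions are closed (each used variable is introduced by a preceding interaction or is a formal parameter of an enclosing recursive definition). $\mathit{var}(\mathcal G)$ is the set of interaction variables and recursion parameters of $\mathcal G$. **Knowledge.** $\mathtt p$ knows $v\in\mathit{var}(\mathcal G)$ if either some interaction $\iota$ in $\mathcal G$ has $v\in\mathit{var}(\iota)$ and $\mathtt p\in\{\mathit{snd}(\iota),\mathit{rcv}(\iota)\}$, or $v$ is a formal parameter of a recursive definition in $\mathcal G$ such that $\mathtt p$ knows all variables of the corresponding initial expression and, for each recursive call of that recursion in its body, all variables of the corresponding actual argument. $\mathtt{knows}_{\mathtt p}(\mathcal G)$ is the set of variables of $\mathcal G$ known by $\mathtt p$. **Assertion trees.** $\mathtt T(\mathcal G)$ is the syntax tree of $\mathcal G$: for $\iota.\mathcal G'$ the root is labelled $\iota$ with unique child the root of $\mathtt T(\mathcal G')$; for a branching the root is labelled $\mathtt s\to\mathtt r$ with children $n_j$ ($j\in J$) labelled $\{\psi_j\}l_j$, each having as unique child the root of $\mathtt T(\mathcal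 G_j)$; for a recursive definition the root is labelled $\mu\,\mathbf t\langle\vec e\rangle\{\vec v\mid\psi\}$ with unique child the root of $\mathtt T(\mathcal G')$, where $\mathcal G'$ is the body; calls and $\mathsf{end}$ give single nodes with these labels. $\underline n$ is the label of node $n$. $\mathtt A(T)$ is the global assertion with tree $T$ (so $\mathtt A(\mathtt T(\mathcal G))=\mathcal G$); global assertions and their trees are identified, and $\mathtt{knows}_{\mathtt p}(T)=\mathtt{knows}_{\mathtt p}(\mathtt A(T))$. For $n\in T$: $\mathit{var}_T(n)=\mathit{var}(\iota)$ if $\underline n=\iota$, else $\emptyset$; $\mathit{cst}_T(n)=\psi$ if $\underline n=\iota$ with $\mathit{cst}(\iota)=\psi$ or $\underline n=\{\psi\}l$, else $\mathsf{true}$; $\mathit{parent}_T(n)$ is the parent; $n\uparrow_T$ is the path from the root to $n$; $\mathtt{PRED}_T(n)$ is the conjunction of $\mathit{cst}_T(m)$ over all proper ancestors $m$ of $n$ ($\mathsf{true}$ for the root). **Temporal satisfiability.** $\mathtt{TS}(\mathcal G)$ holds iff $\mathit{GSat}(\mathcal G,\mathsf{true})$, where $\mathit{GSat}(\mathcal G,\psi)$ holds iff one of: $\mathcal G=\iota.\mathcal G'$, $\psi\supset\exists\mathit{var}(\iota).\mathit{cst}(\iota)$ and $\mathit{GSat}(\mathcal G',\psi\land\mathit{cst}(\iota))$; $\mathcal G$ is a branching with guards $\psi_j$ and continuations $\mathcal G_j$, $\psi\supset\bigvee_{j\in J}\psi_j$ and $\mathit{GSat}(\mathcal G_j,\psi\land\psi_j)$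 for all $j\in J$; $\mathcal G=\mu\,\mathbf t\langle\vec e\rangle\{\vec v\mid\psi'\}.\mathcal G'$, $\psi\supset\psi'[\vec e/\vec v]$ and $\mathit{GSat}(\mathcal G',\psi\land\psi')$; $\mathcal G=\mathbf t\langle\vec e\rangle$ is a call of a recursion with parameters $\vec v$ and invariant $\psi'$, and $\psi\supset\psi'[\vec e/\vec v]$; $\mathcal G=\mathsf{end}$. For a tree, $\mathtt{TS}(T)$ means $\mathtt{TS}(\mathtt A(T))$. For $n\in T$, $\mathtt{TSnode}_T(n)$ holds iff $\mathtt{TS}(T')$ holds, where $T'$ is the tree consisting of the path $n\uparrow_T$ with the children of $n$ (if any) replaced by nodes labelled $\mathsf{end}$; at each branching node on the path all its guard children $\{\psi_j\}l_j$ are retained, those off the path being followed by $\mathsf{end}$. Moreover $\mathtt{TSnode}_T(n)$ is assumed to hold for nodes $n$ labelled $\mathtt s\to\mathtt r$. Finally $$\overline{\mathtt{TS}}(T)=\{n\in T\mid \mathtt{TSnode}_T(n)\text{ is false and }\mathtt{TSnode}_T(n')\text{ is true for all }n'\in\mathit{parent}_T(n)\uparrow_T\},$$ and $\overline{\mathtt{TS}}(\mathcal G)=\overline{\mathtt{TS}}(\mathtt T(\mathcal G))$. It is assumed that only one variable is introduced at interaction nodes where TS is violated. **Algorithm $\Phi_3$ (lifting).** $\mathtt{rewrite}(\psi,v)$ returns (non-deterministically) a pair $(\phi,\psi')$ with $\mathit{var}(\phi)\subseteq\{v\}$ and $\psi\iff\phi\land\psi'$. $\psi$ is in conflict on $\vec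 v$ with $\phi$ in $\psi'$ iff $\psi'\supset\exists\vec v.\phi$ and $\psi'\not\supset\exists\vec v.(\phi\land\psi)$. $\mathtt{split}_T(n,\phi,\psi)$ is the set of $\psi'$ such that, for some $\psi''$, $\psi\iff\psi'\land\psi''$ and $\psi'$ is in conflict on $\mathit{var}_T(n)$ with $\phi\land\psi''$ in $\mathtt{PRED}_T(n)$. $\mathtt{build}_T(n,\psi)$ is the tree $\hat T$ obtained from $T$ by replacing each node $n'\in\mathit{parent}_T(n)\uparrow_T$ with label $\mathtt s\to\mathtt r:\{\vec u\mid\theta\}$ and $\vec u\cap\mathit{var}(\psi)\neq\varnothing$ by a node labelled $\mathtt s\to\mathtt r:\{\vec u\mid\theta\land\forall\vec x.\exists\vec y.\psi\}$, where $\vec x$ are the variables in $\mathit{var}(\psi)\setminus\mathtt{knows}_{\mathtt s}(T)$ introduced in a node of $n'\uparrow_T$ and $\vec y$ are the variables in $\mathit{var}(\psi)$ introduced in a node below $n'$ (empty quantifiers are dropped), provided each such $\theta\land\forall\vec x.\exists\vec y.\psi$ is satisfiable and no $n'\in\mathit{parent}_T(n)\uparrow_T$ is a recursive definition having a formal parameter in $\mathit{var}(\psi)$; otherwise $\mathtt{build}_T(n,\psi)=\bot$. For $n\in\overline{\mathtt{TS}}(T)$, $\mathtt{TSres}_T(n)$ is: $\mathtt{build}_T(n,\phi\land\psi')$ if $\underline n$ is an interaction, $(\phi,\psi)=\mathtt{rewrite}(\mathit{cst}_T(n),\mathit{var}_T(n))$ and there is $\psi'\in\mathtt{split}_T(n,\phi,\psi)$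 with $\mathtt{build}_T(n,\phi\land\psi')\neq\bot$; $\mathtt{build}_T(n,\psi[\vec e/\vec v])$ if $\underline n=\mu\,\mathbf t\langle\vec e\rangle\{\vec v\mid\psi\}$; $\bot$ otherwise. Then $\Phi_3(\mathcal G)=\mathcal G$ if $\mathtt{TS}(\mathcal G)$; $\Phi_3(\mathcal G)=\Phi_3(\mathtt{TSres}_{\mathtt T(\mathcal G)}(n))$ if there is $n\in\overline{\mathtt{TS}}(\mathtt T(\mathcal G))$ with $\mathtt{TSres}_{\mathtt T(\mathcal G)}(n)\neq\bot$; otherwise the failure outcome $\mathsf{fail}(\mathcal G,n)$. *)

theory Defs
  imports Main "HOL-Library.Sublist"
begin

section \<open>Expressions and formulas\<close>

datatype participant = Participant nat
datatype var = Variable nat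
type_synonym label = string
type_synonym recvar = string

text \<open>
  The data values \<open>'d\<close> and the operations \<open>'f\<close> are left open. Relations are
  operations as well, so that they can occur inside expressions; the interpretation
  says which data values count as true.
\<close>

datatype ('f, 'd) expr = Var var | Val 'd | App 'f "('f, 'd) expr list"

datatype ('f, 'd) form =
    Tru
  | Fls
  | Atom "('f, 'd) expr"
  | Neg "('f, 'd) form"
  | And "('f, 'd) form" "('f, 'd) form"
  | Or "('f, 'd) form" "('f, 'd) form"
  | Imp "('f, 'd) form" "('f, 'd) form"
  | Ex var "('f, 'd) form"
  | All var "('f, 'd) form"

record ('f, 'd) interp =
  app :: "'f \<Rightarrow> 'd list \<Rightarrow> 'd"
  truth :: "'d \<Rightarrow> bool"

primrec eval :: "('f, 'd) interp \<Rightarrow> (var \<Rightarrow> 'd) \<Rightarrow> ('f, 'd) expr \<Rightarrow> 'd" where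
  "eval I \<sigma> (Var x) = \<sigma> x"
| "eval I \<sigma> (Val d) = d"
| "eval I \<sigma> (App f es) = app I f (map (eval I \<sigma>) es)"

primrec sat :: "('f, 'd) interp \<Rightarrow> (var \<Rightarrow> 'd) \<Rightarrow> ('f, 'd) form \<Rightarrow> bool" where
  "sat I \<sigma> Tru \<longleftrightarrow> True"
| "sat I \<sigma> Fls \<longleftrightarrow> False"
| "sat I \<sigma> (Atom e) \<longleftrightarrow> truth I (eval I \<sigma> e)"
| "sat I \<sigma> (Neg \<phi>) \<longleftrightarrow> \<not> sat I \<sigma> \<phi>"
| "sat I \<sigma> (And \<phi> \<psi>) \<longleftrightarrow> sat I \<sigma> \<phi> \<and> sat I \<sigma> \<psi>"
| "sat I \<sigma> (Or \<phi> \<psi>) \<longleftrightarrow> sat I \<sigma> \<phi> \<or> sat I \<sigma> \<psi>"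
| "sat I \<sigma> (Imp \<phi> \<psi>) \<longleftrightarrow> (sat I \<sigma> \<phi> \<longrightarrow> sat I \<sigma> \<psi>)"
| "sat I \<sigma> (Ex x \<phi>) \<longleftrightarrow> (\<exists>d. sat I (\<sigma>(x := d)) \<phi>)"
| "sat I \<sigma> (All x \<phi>) \<longleftrightarrow> (\<forall>d. sat I (\<sigma>(x := d)) \<phi>)"

definition valid :: "('f, 'd) interp \<Rightarrow> ('f, 'd) form \<Rightarrow> bool" where
  "valid I \<phi> \<longleftrightarrow> (\<forall>\<sigma>. sat I \<sigma> \<phi>)"

definition satisfiable :: "('f, 'd) interp \<Rightarrow> ('f, 'd) form \<Rightarrow> bool" where
  "satisfiable I \<phi> \<longleftrightarrow> (\<exists>\<sigma>. sat I \<sigma> \<phi>)"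

definition implies :: "('f, 'd) interp \<Rightarrow> ('f, 'd) form \<Rightarrow> ('f, 'd) form \<Rightarrow> bool" where
  "implies I \<phi> \<psi> \<longleftrightarrow> valid I (Imp \<phi> \<psi>)"

definition equivalent :: "('f, 'd) interp \<Rightarrow> ('f, 'd) form \<Rightarrow> ('f, 'd) form \<Rightarrow> bool" where
  "equivalent I \<phi> \<psi> \<longleftrightarrow> implies I \<phi> \<psi> \<and> implies I \<psi> \<phi>"

abbreviation Conj :: "('f, 'd) form list \<Rightarrow> ('f, 'd) form" where
  "Conj \<phi>s \<equiv> foldr And \<phi>s Tru"

abbreviation Disj :: "('f, 'd) form list \<Rightarrow> ('f, 'd) form" where
  "Disj \<phi>s \<equiv> foldr Or \<phi>s Fls"

abbreviation Exs :: "var list \<Rightarrow> ('f, 'd) form \<Rightarrow> ('f, 'd) form" where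
  "Exs xs \<phi> \<equiv> foldr Ex xs \<phi>"

abbreviation Alls :: "var list \<Rightarrow> ('f, 'd) form \<Rightarrow> ('f, 'd) form" where
  "Alls xs \<phi> \<equiv> foldr All xs \<phi>"

primrec evar_list :: "('f, 'd) expr \<Rightarrow> var list" where
  "evar_list (Var x) = [x]"
| "evar_list (Val d) = []"
| "evar_list (App f es) = remdups (concat (map evar_list es))"

primrec fv_list :: "('f, 'd) form \<Rightarrow> var list" where
  "fv_list Tru = []"
| "fv_list Fls = []"
| "fv_list (Atom e) = evar_list e"
| "fv_list (Neg \<phi>) = fv_list \<phi>"
| "fv_list (And \<phi> \<psi>) = remdups (fv_list \<phi> @ fv_list \<psi>)"
| "fv_list (Or \<phi> \<psi>) = remdups (fv_list \<phi> @ fv_list \<psi>)"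
| "fv_list (Imp \<phi> \<psi>) = remdups (fv_list \<phi> @ fv_list \<psi>)"
| "fv_list (Ex x \<phi>) = removeAll x (fv_list \<phi>)"
| "fv_list (All x \<phi>) = removeAll x (fv_list \<phi>)"

abbreviation evars :: "('f, 'd) expr \<Rightarrow> var set" where
  "evars e \<equiv> set (evar_list e)"

abbreviation fv :: "('f, 'd) form \<Rightarrow> var set" where
  "fv \<phi> \<equiv> set (fv_list \<phi>)"

primrec esubst :: "(var \<Rightarrow> ('f, 'd) expr) \<Rightarrow> ('f, 'd) expr \<Rightarrow> ('f, 'd) expr" where
  "esubst \<theta> (Var x) = \<theta> x"
| "esubst \<theta> (Val d) = Val d"
| "esubst \<theta> (App f es) = App f (map (esubst \<theta>) es)"

text \<open>Substitution is capture-avoiding: a quantified variable is renamed when it clashes.\<close>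

definition rename_away :: "var \<Rightarrow> var set \<Rightarrow> var" where
  "rename_away x X = (if x \<notin> X then x else (SOME y. y \<notin> X))"

definition bound_name :: "(var \<Rightarrow> ('f, 'd) expr) \<Rightarrow> var \<Rightarrow> ('f, 'd) form \<Rightarrow> var" where
  "bound_name \<theta> x \<phi> = rename_away x (\<Union>z \<in> fv \<phi> - {x}. evars (\<theta> z))"

primrec fsubst :: "(var \<Rightarrow> ('f, 'd) expr) \<Rightarrow> ('f, 'd) form \<Rightarrow> ('f, 'd) form" where
  "fsubst \<theta> Tru = Tru"
| "fsubst \<theta> Fls = Fls"
| "fsubst \<theta> (Atom e) = Atom (esubst \<theta> e)"
| "fsubst \<theta> (Neg \<phi>) = Neg (fsubst \<theta> \<phi>)"
| "fsubst \<theta> (And \<phi> \<psi>) = And (fsubst \<theta> \<phi>) (fsubst \<theta> \<psi>)"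
| "fsubst \<theta> (Or \<phi> \<psi>) = Or (fsubst \<theta> \<phi>) (fsubst \<theta> \<psi>)"
| "fsubst \<theta> (Imp \<phi> \<psi>) = Imp (fsubst \<theta> \<phi>) (fsubst \<theta> \<psi>)"
| "fsubst \<theta> (Ex x \<phi>) =
    (let y = bound_name \<theta> x \<phi> in Ex y (fsubst (\<theta>(x := Var y)) \<phi>))"
| "fsubst \<theta> (All x \<phi>) =
    (let y = bound_name \<theta> x \<phi> in All y (fsubst (\<theta>(x := Var y)) \<phi>))"

definition subst :: "('f, 'd) form \<Rightarrow> ('f, 'd) expr list \<Rightarrow> var list \<Rightarrow> ('f, 'd) form" where
  "subst \<psi> es vs =
    fsubst (\<lambda>x. case map_of (zip vs es) x of Some e \<Rightarrow> e | None \<Rightarrow> Var x) \<psi>"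


section \<open>Global assertions\<close>

datatype ('f, 'd) interaction =
  Interaction (snd_of: participant) (rcv_of: participant)
    (vars_of: "var list") (cst_of: "('f, 'd) form")

datatype ('f, 'd) ga =
    Prefix "('f, 'd) interaction" "('f, 'd) ga"
  | Branch participant participant "(('f, 'd) form \<times> label \<times> ('f, 'd) ga) list"
  | Mu recvar "('f, 'd) expr list" "var list" "('f, 'd) form" "('f, 'd) ga"
  | Call recvar "('f, 'd) expr list"
  | End

text \<open>
  \<open>closed \<Psi> X \<rho> G\<close>: the formulas of \<open>G\<close> are in \<open>\<Psi>\<close>, its free variables are in \<open>X\<close>, and
  its free recursion variables are declared in \<open>\<rho>\<close>, which records their arity.
\<close>

inductive closed ::
  "('f, 'd) form set \<Rightarrow> var set \<Rightarrow> (recvar \<rightharpoonup> nat) \<Rightarrow> ('f, 'd) ga \<Rightarrow> bool"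
  for \<Psi> :: "('f, 'd) form set"
where
  "cst_of i \<in> \<Psi> \<Longrightarrow> fv (cst_of i) \<subseteq> X \<union> set (vars_of i) \<Longrightarrow>
    closed \<Psi> (X \<union> set (vars_of i)) \<rho> G \<Longrightarrow> closed \<Psi> X \<rho> (Prefix i G)"
| "(\<And>\<psi> l G. (\<psi>, l, G) \<in> set bs \<Longrightarrow> \<psi> \<in> \<Psi> \<and> fv \<psi> \<subseteq> X \<and> closed \<Psi> X \<rho> G) \<Longrightarrow>
    closed \<Psi> X \<rho> (Branch s r bs)"
| "length es = length vs \<Longrightarrow> (\<Union>e \<in> set es. evars e) \<subseteq> X \<Longrightarrow>
    \<psi> \<in> \<Psi> \<Longrightarrow> fv \<psi> \<subseteq> X \<union> set vs \<Longrightarrow>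
    closed \<Psi> (X \<union> set vs) (\<rho>(t \<mapsto> length vs)) G \<Longrightarrow> closed \<Psi> X \<rho> (Mu t es vs \<psi> G)"
| "\<rho> t = Some (length es) \<Longrightarrow> (\<Union>e \<in> set es. evars e) \<subseteq> X \<Longrightarrow> closed \<Psi> X \<rho> (Call t es)"
| "closed \<Psi> X \<rho> End"

fun binders :: "('f, 'd) ga \<Rightarrow> var list" where
  "binders (Prefix i G) = vars_of i @ binders G"
| "binders (Branch s r bs) = concat (map (\<lambda>(\<psi>, l, G). binders G) bs)"
| "binders (Mu t es vs \<psi> G) = vs @ binders G"
| "binders (Call t es) = []"
| "binders End = []"

text \<open>\<open>guarded U G\<close>: no recursion variable in \<open>U\<close> is called in \<open>G\<close> before a communication.\<close>

fun guarded :: "recvar set \<Rightarrow> ('f, 'd) ga \<Rightarrow> bool" where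
  "guarded U (Prefix i G) \<longleftrightarrow> guarded {} G"
| "guarded U (Branch s r bs) \<longleftrightarrow> (\<forall>(\<psi>, l, G) \<in> set bs. guarded {} G)"
| "guarded U (Mu t es vs \<psi> G) \<longleftrightarrow> guarded (insert t U) G"
| "guarded U (Call t es) \<longleftrightarrow> t \<notin> U"
| "guarded U End \<longleftrightarrow> True"

text \<open>
  The distinctness convention concerns the binders of the assertion itself. It cannot extend
  to the quantifiers inside its formulas, since lifting quantifies over variables that are
  also introduced by interactions.
\<close>

definition global_assertion :: "('f, 'd) form set \<Rightarrow> ('f, 'd) ga \<Rightarrow> bool" where
  "global_assertion \<Psi> G \<longleftrightarrow> closed \<Psi> {} Map.empty G \<and> guarded {} G \<and> distinct (binders G)"


section \<open>Assertion trees\<close>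

datatype ('f, 'd) lab =
    LInt "('f, 'd) interaction"
  | LBranch participant participant
  | LGuard "('f, 'd) form" label
  | LMu recvar "('f, 'd) expr list" "var list" "('f, 'd) form"
  | LCall recvar "('f, 'd) expr list"
  | LEnd

datatype ('f, 'd) tree = Node (root_label: "('f, 'd) lab") "('f, 'd) tree list"

fun tree_of :: "('f, 'd) ga \<Rightarrow> ('f, 'd) tree" where
  "tree_of (Prefix i G) = Node (LInt i) [tree_of G]"
| "tree_of (Branch s r bs) =
    Node (LBranch s r) (map (\<lambda>(\<psi>, l, G). Node (LGuard \<psi> l) [tree_of G]) bs)"
| "tree_of (Mu t es vs \<psi> G) = Node (LMu t es vs \<psi>) [tree_of G]"
| "tree_of (Call t es) = Node (LCall t es) []"
| "tree_of End = Node LEnd []"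

definition assertion_of :: "('f, 'd) tree \<Rightarrow> ('f, 'd) ga" where
  "assertion_of T = (THE G. tree_of G = T)"

text \<open>A node is given by its address: the child indices on the path from the root.\<close>

type_synonym node = "nat list"

fun subtree :: "('f, 'd) tree \<Rightarrow> node \<Rightarrow> ('f, 'd) tree option" where
  "subtree T [] = Some T"
| "subtree (Node a Ts) (k # n) = (if k < length Ts then subtree (Ts ! k) n else None)"

definition nodes :: "('f, 'd) tree \<Rightarrow> node set" where
  "nodes T = {n. subtree T n \<noteq> None}"

definition lab_at :: "('f, 'd) tree \<Rightarrow> node \<Rightarrow> ('f, 'd) lab" where
  "lab_at T n = root_label (the (subtree T n))"

definition path_to :: "node \<Rightarrow> node set" where
  "path_to n = {m. prefix m n}"

text \<open>The path to the parent of a node, which is empty for the root.\<close>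

definition path_to_parent :: "node \<Rightarrow> node set" where
  "path_to_parent n = {m. strict_prefix m n}"

definition var_at :: "('f, 'd) tree \<Rightarrow> node \<Rightarrow> var list" where
  "var_at T n = (case lab_at T n of LInt i \<Rightarrow> vars_of i | _ \<Rightarrow> [])"

definition cst_at :: "('f, 'd) tree \<Rightarrow> node \<Rightarrow> ('f, 'd) form" where
  "cst_at T n = (case lab_at T n of LInt i \<Rightarrow> cst_of i | LGuard \<psi> l \<Rightarrow> \<psi> | _ \<Rightarrow> Tru)"

definition PRED :: "('f, 'd) tree \<Rightarrow> node \<Rightarrow> ('f, 'd) form" where
  "PRED T n = Conj (map (\<lambda>k. cst_at T (take k n)) [0..<length n])"

text \<open>
  \<open>calls_of T n t\<close> are the argument lists of the calls of the recursion on \<open>t\<close> defined at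
  \<open>n\<close>; a call belongs to the innermost enclosing definition of its recursion variable.
\<close>

definition calls_of :: "('f, 'd) tree \<Rightarrow> node \<Rightarrow> recvar \<Rightarrow> ('f, 'd) expr list set" where
  "calls_of T n t = {es. \<exists>m \<in> nodes T. strict_prefix n m \<and> lab_at T m = LCall t es \<and>
     \<not> (\<exists>k es' vs' \<psi>'. strict_prefix n k \<and> strict_prefix k m \<and> lab_at T k = LMu t es' vs' \<psi>')}"

inductive_set knows :: "participant \<Rightarrow> ('f, 'd) tree \<Rightarrow> var set"
  for p :: participant and T :: "('f, 'd) tree"
where
  "n \<in> nodes T \<Longrightarrow> lab_at T n = LInt i \<Longrightarrow> v \<in> set (vars_of i) \<Longrightarrow>
    p \<in> {snd_of i, rcv_of i} \<Longrightarrow> v \<in> knows p T"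
| "n \<in> nodes T \<Longrightarrow> lab_at T n = LMu t es vs \<psi> \<Longrightarrow> k < length vs \<Longrightarrow>
    (\<And>x. x \<in> evars (es ! k) \<Longrightarrow> x \<in> knows p T) \<Longrightarrow>
    (\<And>es' x. es' \<in> calls_of T n t \<Longrightarrow> x \<in> evars (es' ! k) \<Longrightarrow> x \<in> knows p T) \<Longrightarrow>
    vs ! k \<in> knows p T"


section \<open>Temporal satisfiability\<close>

text \<open>
  The map \<open>\<rho>\<close> gives the formal parameters and the invariant of each enclosing recursive
  definition.
\<close>

inductive GSat ::
  "('f, 'd) interp \<Rightarrow> (recvar \<rightharpoonup> var list \<times> ('f, 'd) form) \<Rightarrow>
   ('f, 'd) ga \<Rightarrow> ('f, 'd) form \<Rightarrow> bool"
  for I :: "('f, 'd) interp"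
where
  "implies I \<psi> (Exs (vars_of i) (cst_of i)) \<Longrightarrow> GSat I \<rho> G (And \<psi> (cst_of i)) \<Longrightarrow>
    GSat I \<rho> (Prefix i G) \<psi>"
| "implies I \<psi> (Disj (map fst bs)) \<Longrightarrow>
    (\<And>\<psi>' l G. (\<psi>', l, G) \<in> set bs \<Longrightarrow> GSat I \<rho> G (And \<psi> \<psi>')) \<Longrightarrow>
    GSat I \<rho> (Branch s r bs) \<psi>"
| "implies I \<psi> (subst \<psi>' es vs) \<Longrightarrow> GSat I (\<rho>(t \<mapsto> (vs, \<psi>'))) G (And \<psi> \<psi>') \<Longrightarrow>
    GSat I \<rho> (Mu t es vs \<psi>' G) \<psi>"
| "\<rho> t = Some (vs, \<psi>') \<Longrightarrow> implies I \<psi> (subst \<psi>' es vs) \<Longrightarrow> GSat I \<rho> (Call t es) \<psi>"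
| "GSat I \<rho> End \<psi>"

definition TS :: "('f, 'd) interp \<Rightarrow> ('f, 'd) ga \<Rightarrow> bool" where
  "TS I G \<longleftrightarrow> GSat I Map.empty G Tru"

definition TS_tree :: "('f, 'd) interp \<Rightarrow> ('f, 'd) tree \<Rightarrow> bool" where
  "TS_tree I T \<longleftrightarrow> TS I (assertion_of T)"

text \<open>
  \<open>cut T n\<close> keeps the path to \<open>n\<close>, followed by \<open>LEnd\<close>, and the guards next to the path.
\<close>

fun cut :: "('f, 'd) tree \<Rightarrow> node \<Rightarrow> ('f, 'd) tree" where
  "cut (Node a Ts) [] = Node a (map (\<lambda>_. Node LEnd []) Ts)"
| "cut (Node a Ts) (k # n) =
    (case a of
       LBranch s r \<Rightarrow>
         Node a ((map (\<lambda>T. Node (root_label T) [Node LEnd []]) Ts)[k := cut (Ts ! k) n])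
     | _ \<Rightarrow> Node a [cut (Ts ! k) n])"

definition TSnode :: "('f, 'd) interp \<Rightarrow> ('f, 'd) tree \<Rightarrow> node \<Rightarrow> bool" where
  "TSnode I T n \<longleftrightarrow> (\<exists>s r. lab_at T n = LBranch s r) \<or> TS_tree I (cut T n)"

definition TSbar_tree :: "('f, 'd) interp \<Rightarrow> ('f, 'd) tree \<Rightarrow> node set" where
  "TSbar_tree I T =
    {n \<in> nodes T. \<not> TSnode I T n \<and> (\<forall>m \<in> path_to_parent n. TSnode I T m)}"

definition TSbar :: "('f, 'd) interp \<Rightarrow> ('f, 'd) ga \<Rightarrow> node set" where
  "TSbar I G = TSbar_tree I (tree_of G)"


section \<open>The lifting algorithm\<close>

text \<open>The possible results of the non-deterministic rewriting step.\<close>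

definition rewritings ::
  "('f, 'd) form set \<Rightarrow> ('f, 'd) interp \<Rightarrow> ('f, 'd) form \<Rightarrow> var \<Rightarrow>
   (('f, 'd) form \<times> ('f, 'd) form) set"
where
  "rewritings \<Psi> I \<psi> v =
    {(\<phi>, \<psi>'). \<phi> \<in> \<Psi> \<and> \<psi>' \<in> \<Psi> \<and> fv \<phi> \<subseteq> {v} \<and> equivalent I \<psi> (And \<phi> \<psi>')}"

definition in_conflict ::
  "('f, 'd) interp \<Rightarrow> ('f, 'd) form \<Rightarrow> var list \<Rightarrow> ('f, 'd) form \<Rightarrow> ('f, 'd) form \<Rightarrow> bool"
where
  "in_conflict I \<psi> vs \<phi> \<psi>' \<longleftrightarrow>
    implies I \<psi>' (Exs vs \<phi>) \<and> \<not> implies I \<psi>' (Exs vs (And \<phi> \<psi>))"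

definition split ::
  "('f, 'd) form set \<Rightarrow> ('f, 'd) interp \<Rightarrow> ('f, 'd) tree \<Rightarrow> node \<Rightarrow>
   ('f, 'd) form \<Rightarrow> ('f, 'd) form \<Rightarrow> ('f, 'd) form set"
where
  "split \<Psi> I T n \<phi> \<psi> =
    {\<psi>' \<in> \<Psi>. \<exists>\<psi>'' \<in> \<Psi>. equivalent I \<psi> (And \<psi>' \<psi>'') \<and>
       in_conflict I \<psi>' (var_at T n) (And \<phi> \<psi>'') (PRED T n)}"

text \<open>The constraint that replaces that of the interaction \<open>i\<close> at node \<open>m\<close>.\<close>

definition lifted_cst ::
  "('f, 'd) tree \<Rightarrow> node \<Rightarrow> ('f, 'd) interaction \<Rightarrow> ('f, 'd) form \<Rightarrow> ('f, 'd) form"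
where
  "lifted_cst T m i \<psi> =
    (let xs = filter (\<lambda>x. x \<notin> knows (snd_of i) T \<and>
                           (\<exists>k \<in> path_to m. x \<in> set (var_at T k))) (fv_list \<psi>);
         ys = filter (\<lambda>y. \<exists>k \<in> nodes T. strict_prefix m k \<and> y \<in> set (var_at T k)) (fv_list \<psi>)
     in And (cst_of i) (Alls xs (Exs ys \<psi>)))"

definition lifted_lab :: "('f, 'd) tree \<Rightarrow> ('f, 'd) form \<Rightarrow> node \<Rightarrow> ('f, 'd) lab" where
  "lifted_lab T \<psi> m =
    (case lab_at T m of
       LInt i \<Rightarrow>
         if set (vars_of i) \<inter> fv \<psi> \<noteq> {}
         then LInt (Interaction (snd_of i) (rcv_of i) (vars_of i) (lifted_cst T m i \<psi>))
         else LInt i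
     | a \<Rightarrow> a)"

text \<open>\<open>relabel f T n\<close> gives each proper ancestor \<open>m\<close> of \<open>n\<close> the label \<open>f m\<close>.\<close>

fun relabel :: "(node \<Rightarrow> ('f, 'd) lab) \<Rightarrow> ('f, 'd) tree \<Rightarrow> node \<Rightarrow> ('f, 'd) tree" where
  "relabel f T [] = T"
| "relabel f (Node a Ts) (k # n) =
    Node (f []) (Ts[k := relabel (\<lambda>m. f (k # m)) (Ts ! k) n])"

definition build ::
  "('f, 'd) interp \<Rightarrow> ('f, 'd) tree \<Rightarrow> node \<Rightarrow> ('f, 'd) form \<Rightarrow> ('f, 'd) tree option"
where
  "build I T n \<psi> =
    (if (\<forall>m \<in> path_to_parent n. \<forall>i. lab_at T m = LInt i \<and> set (vars_of i) \<inter> fv \<psi> \<noteq> {} \<longrightarrow>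
            satisfiable I (lifted_cst T m i \<psi>)) \<and>
        \<not> (\<exists>m \<in> path_to_parent n. \<exists>t es vs \<theta>.
            lab_at T m = LMu t es vs \<theta> \<and> set vs \<inter> fv \<psi> \<noteq> {})
     then Some (relabel (lifted_lab T \<psi>) T n)
     else None)"

text \<open>
  \<open>TSres \<Psi> I T n T'\<close>: resolving the violation at \<open>n\<close> is defined and may return \<open>T'\<close>. An
  interaction that violates temporal satisfiability is assumed to introduce just one variable.
\<close>

inductive TSres ::
  "('f, 'd) form set \<Rightarrow> ('f, 'd) interp \<Rightarrow> ('f, 'd) tree \<Rightarrow> node \<Rightarrow> ('f, 'd) tree \<Rightarrow> bool"
  for \<Psi> :: "('f, 'd) form set" and I :: "('f, 'd) interp"
where
  "n \<in> TSbar_tree I T \<Longrightarrow> lab_at T n = LInt i \<Longrightarrow> var_at T n = [v] \<Longrightarrow>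
    (\<phi>, \<psi>) \<in> rewritings \<Psi> I (cst_at T n) v \<Longrightarrow> \<psi>' \<in> split \<Psi> I T n \<phi> \<psi> \<Longrightarrow>
    build I T n (And \<phi> \<psi>') = Some T' \<Longrightarrow> TSres \<Psi> I T n T'"
| "n \<in> TSbar_tree I T \<Longrightarrow> lab_at T n = LMu t es vs \<psi> \<Longrightarrow>
    build I T n (subst \<psi> es vs) = Some T' \<Longrightarrow> TSres \<Psi> I T n T'"

datatype ('f, 'd) outcome = Assertion "('f, 'd) ga" | Fail "('f, 'd) ga" node

text \<open>\<open>Phi3 \<Psi> I G R\<close>: the algorithm may terminate on \<open>G\<close> with outcome \<open>R\<close>.\<close>

inductive Phi3 ::
  "('f, 'd) form set \<Rightarrow> ('f, 'd) interp \<Rightarrow> ('f, 'd) ga \<Rightarrow> ('f, 'd) outcome \<Rightarrow> bool"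
  for \<Psi> :: "('f, 'd) form set" and I :: "('f, 'd) interp"
where
  "TS I G \<Longrightarrow> Phi3 \<Psi> I G (Assertion G)"
| "\<not> TS I G \<Longrightarrow> n \<in> TSbar I G \<Longrightarrow> TSres \<Psi> I (tree_of G) n T \<Longrightarrow>
    Phi3 \<Psi> I (assertion_of T) R \<Longrightarrow> Phi3 \<Psi> I G R"
| "\<not> TS I G \<Longrightarrow> \<not> (\<exists>n T. n \<in> TSbar I G \<and> TSres \<Psi> I (tree_of G) n T) \<Longrightarrow> n \<in> TSbar I G \<Longrightarrow>
    Phi3 \<Psi> I G (Fail G n)"

end

theory Submission
  imports Defs
begin

text \<open>
  A run of the algorithm can only end in an assertion that satisfies TS, so it suffices that TS
  holds at every node of such an assertion. Cutting the tree at a node only replaces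
  continuations by \<open>End\<close>, which satisfies every condition, and keeps the constraints on the
  path together with all the guards next to it, so satisfiability is inherited by the cut tree.
\<close>

text \<open>\<open>assertion_of\<close> is a definite description; injectivity guarantees at most
  one candidate, so it inverts \<open>tree_of\<close>.\<close>

lemma tree_of_inject: "tree_of G = tree_of H \<Longrightarrow> G = H"
proof (induction G arbitrary: H rule: tree_of.induct)
  case (1 i G)
  show ?case using "1.prems" by (cases H) (auto dest: "1.IH")
next
  case (2 s r bs)
  from "2.prems" obtain cs where H: "H = Branch s r cs" by (cases H) auto
  let ?f = "\<lambda>(\<psi>, l, G). Node (LGuard \<psi> l) [tree_of G]"
  have eq: "map ?f bs = map ?f cs" using "2.prems" H by simp
  have "bs = cs"
  \<comment> \<open>The induction hypothesis speaks of members of \<open>bs\<close>, so the two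
    lists are compared entry by entry.\<close>
  proof (rule nth_equalityI)
    show len: "length bs = length cs" using map_eq_imp_length_eq[OF eq] .
    fix k assume k: "k < length bs"
    obtain \<psi> l G where b: "bs ! k = (\<psi>, l, G)" by (cases "bs ! k")
    obtain \<psi>' l' G' where c: "cs ! k = (\<psi>', l', G')" by (cases "cs ! k")
    have "?f (bs ! k) = ?f (cs ! k)" using arg_cong[OF eq, of "\<lambda>xs. xs ! k"] k len by simp
    then have *: "\<psi> = \<psi>'" "l = l'" "tree_of G = tree_of G'" using b c by auto
    have "(\<psi>, l, G) \<in> set bs" using nth_mem[OF k] b by simp
    from "2.IH"[OF this refl refl *(3)] show "bs ! k = cs ! k" using b c * by simp
  qed
  then show ?case using H by simp
next
  case (3 t es vs \<psi> G)
  show ?case using "3.prems" by (cases H) (auto dest: "3.IH")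
next
  case (4 t es)
  then show ?case by (cases H) auto
next
  case 5
  then show ?case by (cases H) auto
qed

lemma assertion_of_tree_of [simp]: "assertion_of (tree_of G) = G"
  unfolding assertion_of_def by (rule the_equality) (auto dest: tree_of_inject)

lemma lab_at_Nil [simp]: "lab_at (Node a Ts) [] = a"
  by (simp add: lab_at_def)

lemma lab_at_Cons [simp]: "k < length Ts \<Longrightarrow> lab_at (Node a Ts) (k # n) = lab_at (Ts ! k) n"
  by (simp add: lab_at_def)

lemma nodes_Cons [simp]: "k # n \<in> nodes (Node a Ts) \<longleftrightarrow> k < length Ts \<and> n \<in> nodes (Ts ! k)"
  by (simp add: nodes_def)

inductive_cases GSat_PrefixE: "GSat I \<rho> (Prefix i G) \<psi>"
inductive_cases GSat_BranchE: "GSat I \<rho> (Branch s r bs) \<psi>"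
inductive_cases GSat_MuE: "GSat I \<rho> (Mu t es vs \<theta> G) \<psi>"

text \<open>
  Branching nodes are excluded because cutting there puts \<open>LEnd\<close> in place of the guards, which
  does not leave the tree of an assertion.
\<close>

lemma GSat_cut:
  assumes "n \<in> nodes (tree_of G)" and "\<And>s r. lab_at (tree_of G) n \<noteq> LBranch s r"
  shows "\<exists>H. tree_of H = cut (tree_of G) n \<and> (\<forall>\<rho> \<psi>. GSat I \<rho> G \<psi> \<longrightarrow> GSat I \<rho> H \<psi>)"
  using assms
proof (induction G arbitrary: n rule: tree_of.induct)
  case (1 i G)
  \<comment> \<open>Wraps a cut continuation \<open>H\<close> back under the prefix. It must work
    for every \<open>\<psi>\<close>, since below the prefix the context has grown by
    \<open>cst_of i\<close>.\<close>
  have *: ?case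
    if "tree_of (Prefix i H) = cut (tree_of (Prefix i G)) n"
      and "\<forall>\<rho> \<psi>. GSat I \<rho> G \<psi> \<longrightarrow> GSat I \<rho> H \<psi>" for H
    using that by (intro exI[of _ "Prefix i H"]) (auto elim!: GSat_PrefixE intro!: GSat.intros(1))
  show ?case
  proof (cases n)
    case Nil
    \<comment> \<open>Cutting at the prefix itself leaves \<open>LEnd\<close> as its only
      child.\<close>
    then show ?thesis by (intro *[of End]) (auto intro: GSat.intros(5))
  next
    case (Cons k m)
    with "1.prems" have "m \<in> nodes (tree_of G)" "\<And>s r. lab_at (tree_of G) m \<noteq> LBranch s r"
      by auto
    from "1.IH"[OF this] obtain H where "tree_of H = cut (tree_of G) m"
      "\<forall>\<rho> \<psi>. GSat I \<rho> G \<psi> \<longrightarrow> GSat I \<rho> H \<psi>" by blast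
    then show ?thesis using Cons "1.prems"(1) by (intro *[of H]) auto
  qed
next
  case (2 s r bs)
  have "n \<noteq> []" using "2.prems"(2)[of s r] by auto
  then obtain k m where n: "n = k # m" by (cases n) auto
  have k: "k < length bs" using "2.prems"(1) n by simp
  obtain \<psi>\<^sub>k l\<^sub>k G\<^sub>k where b: "bs ! k = (\<psi>\<^sub>k, l\<^sub>k, G\<^sub>k)" by (cases "bs ! k")
  have mem: "(\<psi>\<^sub>k, l\<^sub>k, G\<^sub>k) \<in> set bs" using nth_mem[OF k] b by simp
  \<comment> \<open>The path enters the guard node of branch \<open>k\<close>. It either stops
    there, giving \<open>End\<close>, or passes to the only child, where the induction hypothesis
    applies.\<close>
  have "\<exists>H. Node (LGuard \<psi>\<^sub>k l\<^sub>k) [tree_of H] = cut (Node (LGuard \<psi>\<^sub>k l\<^sub>k) [tree_of G\<^sub>k]) m \<and>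
      (\<forall>\<rho> \<psi>. GSat I \<rho> G\<^sub>k \<psi> \<longrightarrow> GSat I \<rho> H \<psi>)"
  proof (cases m)
    case Nil
    then show ?thesis by (intro exI[of _ End]) (auto intro: GSat.intros(5))
  next
    case (Cons j m')
    with "2.prems" n k b have "j = 0" "m' \<in> nodes (tree_of G\<^sub>k)"
      "\<And>s r. lab_at (tree_of G\<^sub>k) m' \<noteq> LBranch s r" by auto
    then show ?thesis using "2.IH"[OF mem refl refl, of m'] Cons by auto
  qed
  then obtain H where
    H: "Node (LGuard \<psi>\<^sub>k l\<^sub>k) [tree_of H] = cut (Node (LGuard \<psi>\<^sub>k l\<^sub>k) [tree_of G\<^sub>k]) m"
    and GH: "\<And>\<rho> \<psi>. GSat I \<rho> G\<^sub>k \<psi> \<Longrightarrow> GSat I \<rho> H \<psi>" by blast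
  \<comment> \<open>Branch \<open>k\<close> continues with the cut \<open>H\<close>, every other
    branch with \<open>End\<close>; all guards survive, so the disjunction required at the branching
    is unchanged.\<close>
  define cs where "cs = (map (\<lambda>(\<psi>, l, G). (\<psi>, l, End)) bs)[k := (\<psi>\<^sub>k, l\<^sub>k, H)]"
  have guards: "map fst cs = map fst bs"
    unfolding cs_def using k b by (intro nth_equalityI) (auto simp: nth_list_update split: prod.split)
  have tree: "tree_of (Branch s r cs) = cut (tree_of (Branch s r bs)) n"
    unfolding cs_def n using k b H
    by (auto simp: map_update intro!: arg_cong[of _ _ "\<lambda>xs. xs[k := _]"])
  have "GSat I \<rho> (Branch s r cs) \<psi>" if "GSat I \<rho> (Branch s r bs) \<psi>" for \<rho> \<psi>
  proof -
    from that have imp: "implies I \<psi> (Disj (map fst bs))"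
      and sub: "\<And>\<psi>' l G. (\<psi>', l, G) \<in> set bs \<Longrightarrow> GSat I \<rho> G (And \<psi> \<psi>')"
      by (auto elim: GSat_BranchE)
    show ?thesis
    proof (rule GSat.intros(2))
      show "implies I \<psi> (Disj (map fst cs))" using imp guards by simp
      fix \<psi>' l G assume "(\<psi>', l, G) \<in> set cs"
      then consider "(\<psi>', l, G) = (\<psi>\<^sub>k, l\<^sub>k, H)" | "G = End"
        unfolding cs_def using set_update_subset_insert by fastforce
      then show "GSat I \<rho> G (And \<psi> \<psi>')"
        by cases (use GH sub[OF mem] in \<open>auto intro: GSat.intros(5)\<close>)
    qed
  qed
  then show ?case using tree by blast
next
  case (3 t es vs \<theta> G)
  \<comment> \<open>As for a prefix, now with \<open>\<rho>\<close> also growing by the entry for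
    \<open>t\<close>.\<close>
  have *: ?case
    if "tree_of (Mu t es vs \<theta> H) = cut (tree_of (Mu t es vs \<theta> G)) n"
      and "\<forall>\<rho> \<psi>. GSat I \<rho> G \<psi> \<longrightarrow> GSat I \<rho> H \<psi>" for H
    using that by (intro exI[of _ "Mu t es vs \<theta> H"]) (auto elim!: GSat_MuE intro!: GSat.intros(3))
  show ?case
  proof (cases n)
    case Nil
    then show ?thesis by (intro *[of End]) (auto intro: GSat.intros(5))
  next
    case (Cons k m)
    with "3.prems" have "m \<in> nodes (tree_of G)" "\<And>s r. lab_at (tree_of G) m \<noteq> LBranch s r"
      by auto
    from "3.IH"[OF this] obtain H where "tree_of H = cut (tree_of G) m"
      "\<forall>\<rho> \<psi>. GSat I \<rho> G \<psi> \<longrightarrow> GSat I \<rho> H \<psi>" by blast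
    then show ?thesis using Cons "3.prems"(1) by (intro *[of H]) auto
  qed
next
  case (4 t es)
  \<comment> \<open>A call is a leaf: its root is its only node, and cutting there changes
    nothing.\<close>
  then show ?case by (cases n) (auto intro!: exI[of _ "Call t es"])
next
  case 5
  then show ?case by (cases n) (auto intro!: exI[of _ End])
qed

text \<open>Branching nodes satisfy \<open>TSnode\<close> by convention; elsewhere
  \<open>GSat_cut\<close> supplies the assertion that \<open>assertion_of\<close> reads off the cut
  tree.\<close>

lemma TSnode_if_TS:
  assumes "TS I G" and "n \<in> nodes (tree_of G)"
  shows "TSnode I (tree_of G) n"
proof (cases "\<exists>s r. lab_at (tree_of G) n = LBranch s r")
  case False
  then obtain H where "tree_of H = cut (tree_of G) n" "GSat I Map.empty H Tru"
    using GSat_cut[of n G I] assms unfolding TS_def by blast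
  then show ?thesis unfolding TSnode_def TS_tree_def TS_def by (metis assertion_of_tree_of)
qed (simp add: TSnode_def)

text \<open>A successful run ends with the rule that tests \<open>TS\<close>; a lifting step only
  passes on the outcome of the rest of the run.\<close>

lemma Phi3_Assertion_TS: "Phi3 \<Psi> I G (Assertion G') \<Longrightarrow> TS I G'"
  by (induction G "Assertion G'" rule: Phi3.induct) auto

theorem theorem43:
  fixes \<Psi> :: "('f, 'd) form set" and I :: "('f, 'd) interp" and G G' :: "('f, 'd) ga"
  assumes "global_assertion \<Psi> G" and "global_assertion \<Psi> G'"
    and "Phi3 \<Psi> I G (Assertion G')"
  shows "TSbar I G' = {}"
  using TSnode_if_TS[OF Phi3_Assertion_TS[OF assms(3)]]
  by (auto simp: TSbar_def TSbar_tree_def)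

end
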